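(* Let $p\ge 1$ and $t$ be integers with $t \geq 2p+1$, and let $G=C_3^tC_5^p$. Then 1. $G$ is graceful when $p\equiv 0\pmod 4$ and $t\equiv 0,1\pmod 4$; 2. $G$ is graceful when $p\equiv 3\pmod 4$ and $t\equiv 0,3\pmod 4$; 3. $G$ is near graceful when $p\equiv 1\pmod 4$ and $t\equiv 0,3\pmod 4$; 4. $G$ is near graceful when $p\equiv 2\pmod 4$ and $t\equiv 0,1\pmod 4$.
   Context: $C_n^t$ denotes the union of $t$ cycles of length $n$ sharing exactly one common (central) vertex, and $C_3^tC_5^p$ denotes the graph obtained by identifying the central vertices of $C_3^t$ and $C_5^p$. For a graph $G$ with $m$ edges, a graceful labelling is an injective map $f:V(G)\to\{0,\ldots,m\}$ such that $g(uv)=|f(u)-f(v)|$ is a bijection $E(G)\to\{1,\ldots,m\}$. A near graceful labelling is an injective map $f:V(G)\to\{0,\ldots,m+1\}$ such that $g(uv)=|f(u)-f(v)|$ is a bijection onto $\{1,\ldots,m-1,m\}$ or onto $\{1,\ldots,m-1,m+1\}$. A graph is (near) graceful if it admits such a labelling. *)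

theory Defs
  imports Main
begin

datatype 'v ugraph = Graph (verts: "'v set") (edges: "'v set set")

text \<open>Edges are two-element vertex sets; \<open>g\<close> is the edge labelling induced by
  the vertex labelling \<open>f\<close>.\<close>

definition induced_edge_labelling :: "'v ugraph \<Rightarrow> ('v \<Rightarrow> int) \<Rightarrow> ('v set \<Rightarrow> int) \<Rightarrow> bool" where
  "induced_edge_labelling G f g \<longleftrightarrow>
     (\<forall>u v. {u, v} \<in> edges G \<longrightarrow> g {u, v} = \<bar>f u - f v\<bar>)"

definition graceful_labelling :: "'v ugraph \<Rightarrow> ('v \<Rightarrow> int) \<Rightarrow> bool" where
  "graceful_labelling G f \<longleftrightarrow>
     (let m = int (card (edges G)) in
        inj_on f (verts G) \<and> f ` verts G \<subseteq> {0..m} \<and>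
        (\<exists>g. induced_edge_labelling G f g \<and> bij_betw g (edges G) {1..m}))"

definition near_graceful_labelling :: "'v ugraph \<Rightarrow> ('v \<Rightarrow> int) \<Rightarrow> bool" where
  "near_graceful_labelling G f \<longleftrightarrow>
     (let m = int (card (edges G)) in
        inj_on f (verts G) \<and> f ` verts G \<subseteq> {0..m + 1} \<and>
        (\<exists>g. induced_edge_labelling G f g \<and>
             (bij_betw g (edges G) {1..m} \<or>
              bij_betw g (edges G) ({1..m - 1} \<union> {m + 1}))))"

definition graceful :: "'v ugraph \<Rightarrow> bool" where
  "graceful G \<longleftrightarrow> (\<exists>f. graceful_labelling G f)"

definition near_graceful :: "'v ugraph \<Rightarrow> bool" where
  "near_graceful G \<longleftrightarrow> (\<exists>f. near_graceful_labelling G f)"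

text \<open>Graphs with a central vertex use an option type, with \<open>None\<close> as the central
  vertex. The \<open>i\<close>-th cycle visits \<open>cycle_vertex i 0, \<dots>, cycle_vertex i (n - 1)\<close>
  in this order; \<open>cycle_vertex i 0\<close> is the centre for every \<open>i\<close>.\<close>

definition cycle_vertex :: "nat \<Rightarrow> nat \<Rightarrow> (nat \<times> nat) option" where
  "cycle_vertex i j = (if j = 0 then None else Some (i, j))"

text \<open>The graph $C_n^t$, for \<open>n \<ge> 3\<close>.\<close>

definition cycles_at_point :: "nat \<Rightarrow> nat \<Rightarrow> (nat \<times> nat) option ugraph" where
  "cycles_at_point n t = Graph
     (insert None {cycle_vertex i j | i j. i < t \<and> j < n})
     {{cycle_vertex i j, cycle_vertex i ((j + 1) mod n)} | i j. i < t \<and> j < n}"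

text \<open>Disjoint union with the two central vertices identified.\<close>

definition join_centres :: "'a option ugraph \<Rightarrow> 'b option ugraph \<Rightarrow> ('a + 'b) option ugraph" where
  "join_centres G H = Graph
     (map_option Inl ` verts G \<union> map_option Inr ` verts H)
     ((`) (map_option Inl) ` edges G \<union> (`) (map_option Inr) ` edges H)"

end

theory Submission
  imports Defs
begin

text \<open>
  The centre gets the label 0. A triangle with further labels \<open>y < z\<close> has edge labels \<open>y\<close>, \<open>z\<close>, \<open>z - y\<close>;
  hence a perfect Langford sequence of defect \<open>p + 1\<close> and order \<open>t\<close>, shifted by \<open>p + t\<close>, labels the \<open>t\<close>
  triangles such that their edge labels are exactly \<open>p + 1, \<dots>, p + 3 t\<close>. Such sequences exist since
  \<open>t \<ge> 2 (p + 1) - 1\<close> and the parities are right in all four cases.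

  A pentagon with labels \<open>0, a, b, c, d\<close>, where \<open>a\<close>, \<open>d\<close> are large and \<open>b\<close>, \<open>c\<close> are small, has edge labels
  \<open>a\<close>, \<open>a - b\<close>, \<open>d\<close>, \<open>d - c\<close>, \<open>\<bar>b - c\<bar>\<close>. So the \<open>p\<close> pentagons can use up the remaining labels if the \<open>4 p\<close>
  largest labels can be split into pairs with distinct differences and these differences can in turn be
  split into pairs with differences \<open>1, \<dots>, p\<close>. A parity argument shows that for \<open>p \<equiv> 1, 2\<close> modulo 4 the
  largest label has to be moved up by one, which is why the labelling is only near graceful then.

  All these pairings are unions of nests \<open>(a, b), (a + 1, b - 1), \<dots>\<close>. It suffices to check that they
  cover the required labels; disjointness follows by counting.
\<close>

section \<open>Nests of pairs, their ends and their gaps\<close>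

definition nest :: "int \<Rightarrow> int \<Rightarrow> int \<Rightarrow> (int \<times> int) list" where
  "nest a b n = map (\<lambda>j. (a + j, b - j)) [0..n - 1]"

definition ends :: "(int \<times> int) list \<Rightarrow> int list" where
  "ends L = map fst L @ map snd L"

definition gaps :: "(int \<times> int) list \<Rightarrow> int list" where
  "gaps L = map (\<lambda>(x, y). y - x) L"

lemma length_nest [simp]: "length (nest a b n) = nat n"
  by (simp add: nest_def)

lemma length_ends [simp]: "length (ends L) = 2 * length L"
  by (simp add: ends_def)

lemma length_gaps [simp]: "length (gaps L) = length L"
  by (simp add: gaps_def)

lemma set_ends_append [simp]: "set (ends (L @ L')) = set (ends L) \<union> set (ends L')"
  by (auto simp: ends_def)

lemma set_gaps_append [simp]: "set (gaps (L @ L')) = set (gaps L) \<union> set (gaps L')"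
  by (simp add: gaps_def)

lemma in_ends_nest [simp]:
  "z \<in> set (ends (nest a b n)) \<longleftrightarrow> (a \<le> z \<and> z < a + n) \<or> (b - n < z \<and> z \<le> b)"
proof -
  have "set (ends (nest a b n)) = {a..n - 1 + a} \<union> {b - (n - 1)..b}"
    by (simp add: ends_def nest_def image_image)
  then show ?thesis
    by auto
qed

text \<open>The gaps decrease in steps of 2. Bounds and a parity condition, free of quantifiers, let
  linear arithmetic decide membership once parities are fixed.\<close>

lemma in_gaps_nest [simp]:
  "z \<in> set (gaps (nest a b n)) \<longleftrightarrow> b - a - 2 * n < z \<and> z \<le> b - a \<and> even (b - a - z)"
proof -
  have "(\<exists>j. 0 \<le> j \<and> j \<le> n - 1 \<and> z = b - j - (a + j)) \<longleftrightarrow>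
      b - a - 2 * n < z \<and> z \<le> b - a \<and> even (b - a - z)" (is "?l \<longleftrightarrow> ?r")
  proof
    assume ?r
    then obtain k where "b - a - z = 2 * k"
      by (elim conjE dvdE)
    with \<open>?r\<close> show ?l
      by (intro exI[of _ k]) linarith
  qed auto
  moreover have "set (gaps (nest a b n)) = (\<lambda>j. b - j - (a + j)) ` {0..n - 1}"
    by (simp add: gaps_def nest_def image_image)
  ultimately show ?thesis
    by (simp add: image_iff Bex_def)
qed

lemmas in_ends_iffs = set_ends_append in_ends_nest Un_iff Diff_iff insert_iff empty_iff atLeastAtMost_iff

lemmas in_gaps_iffs = set_gaps_append in_gaps_nest Un_iff Diff_iff insert_iff empty_iff atLeastAtMost_iff

text \<open>Pigeonhole: a list with only as many entries as the set it covers can neither repeat an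
  element nor leave that set. This turns each exactness claim about a table into a covering
  claim.\<close>

lemma covering_list:
  assumes "A \<subseteq> set xs" and "card A = length xs"
  shows "set xs = A" and "distinct xs"
proof -
  have "card (set xs) \<le> card A"
    using assms(2) by (simp add: card_length)
  then show "set xs = A"
    using assms(1) by (metis List.finite_set card_seteq)
  then show "distinct xs"
    using assms(2) by (simp add: card_distinct)
qed

lemma in_gaps_iff: "e \<in> set (gaps L) \<longleftrightarrow> (\<exists>x. (x, x + e) \<in> set L)"
  unfolding gaps_def set_map image_iff by (metis (no_types, lifting) add_diff_cancel_left' case_prod_conv
      diff_add_cancel add.commute prod.exhaust)

text \<open>The pairs \<open>(x, y)\<close> of \<open>L\<close> are the positions of the two occurrences of \<open>y - x\<close> in a perfect
  Langford sequence of defect \<open>d\<close> and order \<open>l\<close>.\<close>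

definition langford :: "int \<Rightarrow> int \<Rightarrow> (int \<times> int) list \<Rightarrow> bool" where
  "langford d l L \<longleftrightarrow>
     int (length L) = l \<and> set (ends L) = {1..2 * l} \<and> set (gaps L) = {d..<d + l}"

text \<open>A pair \<open>(b, c)\<close> of \<open>V\<close> yields the pentagon with labels \<open>0, x' + b, b, c, y' + c\<close>, where
  \<open>(x', x' + b)\<close> and \<open>(y', y' + c)\<close> are the pairs of \<open>P\<close> (shifted to the top of the label range) with
  gaps \<open>b\<close> and \<open>c\<close>. Its edge labels are the four ends of these two pairs and \<open>c - b\<close>.\<close>

definition pentagons :: "int \<Rightarrow> int set \<Rightarrow> (int \<times> int) list \<Rightarrow> (int \<times> int) list \<Rightarrow> bool" where
  "pentagons p W P V \<longleftrightarrow>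
     int (length V) = p \<and> int (card W) = 4 * p \<and>
     set (ends P) = W \<and> distinct (gaps P) \<and> set (gaps P) = set (ends V) \<and>
     distinct (ends V) \<and> set (ends V) \<subseteq> {1..3 * p + 1} \<and> set (gaps V) = {1..p}"

section \<open>From numerical data to a labelling of the graph\<close>

lemma edges_cycles_at_point:
  "edges (cycles_at_point n t) =
     (\<lambda>(i, j). {cycle_vertex i j, cycle_vertex i ((j + 1) mod n)}) ` ({..<t} \<times> {..<n})"
  by (auto simp: cycles_at_point_def)

lemma verts_cycles_at_point:
  "verts (cycles_at_point n t) \<subseteq> insert None (Some ` ({..<t} \<times> {0<..<n}))"
  by (auto simp: cycles_at_point_def cycle_vertex_def split: if_splits)

text \<open>The threshold \<open>K\<close> separates the vertices \<open>b\<close>, \<open>c\<close>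
  from the neighbours of the centre. As the centre has label 0, its edge to a neighbour carries that
  neighbour's own label, so neighbours get distinct labels once the edge labels are distinct. Hence
  injectivity is assumed for \<open>b\<close> and \<open>c\<close> only.\<close>

lemma windmill_labelling:
  fixes t p :: nat and y z a b c d :: "nat \<Rightarrow> int" and K :: int and X :: "int set"
  defines "G \<equiv> join_centres (cycles_at_point 3 t) (cycles_at_point 5 p)"
  assumes "K \<ge> 0" and cardX: "card X = 3 * t + 5 * p"
    and cover: "X \<subseteq> (\<Union>i<t. {y i, z i, \<bar>y i - z i\<bar>}) \<union>
      (\<Union>i<p. {a i, \<bar>a i - b i\<bar>, \<bar>b i - c i\<bar>, \<bar>c i - d i\<bar>, d i})"
    and outer: "\<And>i. i < t \<Longrightarrow> K < y i \<and> K < z i" "\<And>i. i < p \<Longrightarrow> K < a i \<and> K < d i"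
    and inner: "\<And>i. i < p \<Longrightarrow> b i \<in> {1..K} \<and> c i \<in> {1..K}"
    and inj: "inj_on b {..<p}" "inj_on c {..<p}" "\<And>i j. i < p \<Longrightarrow> j < p \<Longrightarrow> b i \<noteq> c j"
  shows "\<exists>f g. card (edges G) = 3 * t + 5 * p \<and> inj_on f (verts G) \<and>
    f ` verts G \<subseteq> {0..K} \<union> X \<and> induced_edge_labelling G f g \<and> bij_betw g (edges G) X"
proof -
  define f :: "(nat \<times> nat + nat \<times> nat) option \<Rightarrow> int" where
    "f v = (case v of None \<Rightarrow> 0
       | Some (Inl (i, j)) \<Rightarrow> (if j = 1 then y i else z i)
       | Some (Inr (i, j)) \<Rightarrow> (if j = 1 then a i else if j = 2 then b i else if j = 3 then c i else d i))" for v
  \<comment> \<open>Maximum minus minimum is a function of the edge as a set, with no choice of an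
    order of its ends.\<close>
  define g where "g e = Max (f ` e) - Min (f ` e)" for e
  define E where "E = case_sum
    (\<lambda>(i, j). map_option Inl ` {cycle_vertex i j, cycle_vertex i ((j + 1) mod 3)})
    (\<lambda>(i, j). map_option Inr ` {cycle_vertex i j, cycle_vertex i ((j + 1) mod 5)})"
  let ?I = "({..<t} \<times> {..<3::nat}) <+> ({..<p} \<times> {..<5::nat})"
  have g: "g {u, v} = \<bar>f u - f v\<bar>" for u v
    by (auto simp: g_def)
  have edges: "edges G = E ` ?I"
    by (auto simp: G_def join_centres_def edges_cycles_at_point E_def Plus_def image_Un image_image
        case_prod_beta)
  have Inl: "Inl (i, j) \<in> ?I \<longleftrightarrow> i < t \<and> j < 3" and Inr: "Inr (i, j) \<in> ?I \<longleftrightarrow> i < p \<and> j < 5" for i j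
    by auto
  have card_I: "card ?I = 3 * t + 5 * p"
    by (simp add: card_Plus)
  have E3: "E (Inl (i, 0)) = {None, Some (Inl (i, 1))}"
      "E (Inl (i, 1)) = {Some (Inl (i, 1)), Some (Inl (i, 2))}"
      "E (Inl (i, 2)) = {None, Some (Inl (i, 2))}" for i
    by (auto simp: E_def cycle_vertex_def)
  have E5: "E (Inr (i, 0)) = {None, Some (Inr (i, 1))}"
      "E (Inr (i, 1)) = {Some (Inr (i, 1)), Some (Inr (i, 2))}"
      "E (Inr (i, 2)) = {Some (Inr (i, 2)), Some (Inr (i, 3))}"
      "E (Inr (i, 3)) = {Some (Inr (i, 3)), Some (Inr (i, 4))}"
      "E (Inr (i, 4)) = {None, Some (Inr (i, 4))}" for i
    by (auto simp: E_def cycle_vertex_def)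
  have "X \<subseteq> (g \<circ> E) ` ?I"
  proof
    fix x assume "x \<in> X"
    with cover consider i where "i < t" "x \<in> {y i, z i, \<bar>y i - z i\<bar>}"
      | i where "i < p" "x \<in> {a i, \<bar>a i - b i\<bar>, \<bar>b i - c i\<bar>, \<bar>c i - d i\<bar>, d i}"
      by blast
    then show "x \<in> (g \<circ> E) ` ?I"
    proof cases
      case 1
      then have "x \<in> {(g \<circ> E) (Inl (i, 0)), (g \<circ> E) (Inl (i, 1)), (g \<circ> E) (Inl (i, 2))}"
        using outer(1)[OF 1(1)] \<open>K \<ge> 0\<close> by (auto simp: E3 g f_def simp del: One_nat_def)
      with 1(1) show ?thesis
        by auto
    next
      case 2
      then have "x \<in> {(g \<circ> E) (Inr (i, 0)), (g \<circ> E) (Inr (i, 1)), (g \<circ> E) (Inr (i, 2)),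
          (g \<circ> E) (Inr (i, 3)), (g \<circ> E) (Inr (i, 4))}"
        using outer(2)[OF 2(1)] \<open>K \<ge> 0\<close> by (auto simp: E5 g f_def simp del: One_nat_def)
      with 2(1) show ?thesis
        by auto
    qed
  qed
  \<comment> \<open>\<open>?I\<close> and \<open>X\<close> have the same size, so covering makes
    \<open>E\<close> followed by \<open>g\<close> a bijection. Then \<open>E\<close> is injective,
    which counts the edges, and \<open>g\<close> is injective on edges; no edges are compared
    pairwise.\<close>
  then have im: "(g \<circ> E) ` ?I = X"
    using cardX card_I card_image_le[of ?I "g \<circ> E"] card_seteq[of "(g \<circ> E) ` ?I" X] by auto
  then have inj_gE: "inj_on (g \<circ> E) ?I"
    using cardX card_I by (intro eq_card_imp_inj_on) auto
  have card_edges: "card (edges G) = 3 * t + 5 * p"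
    using card_image[OF inj_on_imageI2[OF inj_gE]] card_I edges by simp
  have bij: "bij_betw g (edges G) X"
    using inj_on_imageI[OF inj_gE] im by (simp add: bij_betw_def edges image_comp)
  have induced: "induced_edge_labelling G f g"
    by (simp add: induced_edge_labelling_def g)
  \<comment> \<open>\<open>N\<close> holds the neighbours of the centre together with a witnessing
    edge, which identifies \<open>f v\<close> with an edge label; \<open>M\<close> holds the other
    vertices.\<close>
  define N where "N = {v. K < f v \<and> (\<exists>e \<in> ?I. E e = {None, v})}"
  define M :: "(nat \<times> nat + nat \<times> nat) option set" where
    "M = {Some (Inr (i, j)) | i j. i < p \<and> j \<in> {2, 3}}"
  have NI: "e \<in> ?I \<Longrightarrow> E e = {None, v} \<Longrightarrow> K < f v \<Longrightarrow> v \<in> N" for e v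
    unfolding N_def by blast
  have "verts G \<subseteq> map_option Inl ` insert None (Some ` ({..<t} \<times> {0<..<3}))
      \<union> map_option Inr ` insert None (Some ` ({..<p} \<times> {0<..<5}))"
    unfolding G_def join_centres_def ugraph.sel
    by (intro Un_mono image_mono verts_cycles_at_point)
  then have verts_G: "v \<in> insert None ((Some \<circ> Inl) ` ({..<t} \<times> {0<..<3}) \<union> (Some \<circ> Inr) ` ({..<p} \<times> {0<..<5}))"
    if "v \<in> verts G" for v
    using that by (auto simp: image_image)
  have verts: "verts G \<subseteq> insert None (N \<union> M)"
  proof
    fix v assume "v \<in> verts G"
    from verts_G[OF this] consider "v = None" | i j where "v = Some (Inl (i, j))" "i < t" "0 < j" "j < 3"
      | i j where "v = Some (Inr (i, j))" "i < p" "0 < j" "j < 5"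
      by auto
    then show "v \<in> insert None (N \<union> M)"
    proof cases
      case 2
      then have "j = 1 \<or> j = 2"
        by auto
      then have "v \<in> N"
      proof
        assume "j = 1"
        then show ?thesis
          using NI[of "Inl (i, 0)" v] 2(1,2) outer(1)[OF 2(2)] by (simp add: E3 Inl f_def)
      next
        assume "j = 2"
        then show ?thesis
          using NI[of "Inl (i, 2)" v] 2(1,2) outer(1)[OF 2(2)] by (simp add: E3 Inl f_def)
      qed
      then show ?thesis
        by blast
    next
      case 3
      then have "j = 1 \<or> j = 4 \<or> j \<in> {2, 3}"
        by auto
      then have "v \<in> N \<or> v \<in> M"
      proof (elim disjE)
        assume "j = 1"
        then show ?thesis
          using NI[of "Inr (i, 0)" v] 3(1,2) outer(2)[OF 3(2)] by (simp add: E5 Inr f_def)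
      next
        assume "j = 4"
        then show ?thesis
          using NI[of "Inr (i, 4)" v] 3(1,2) outer(2)[OF 3(2)] by (simp add: E5 Inr f_def)
      next
        assume "j \<in> {2, 3}"
        then show ?thesis
          using 3(1,2) unfolding M_def by blast
      qed
      then show ?thesis
        by blast
    qed simp
  qed
  have "f None = 0"
    by (simp add: f_def)
  have N: "K < f v" "f v \<in> X" "{None, v} \<in> edges G" "g {None, v} = f v" if "v \<in> N" for v
  proof -
    from that obtain e where e: "e \<in> ?I" "E e = {None, v}"
      by (auto simp: N_def)
    show "K < f v"
      using that by (simp add: N_def)
    then show gv: "g {None, v} = f v"
      using \<open>K \<ge> 0\<close> \<open>f None = 0\<close> by (simp add: g)
    have "(g \<circ> E) e \<in> X"
      using e(1) im by blast
    then show "f v \<in> X"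
      using e(2) gv by simp
    show "{None, v} \<in> edges G"
      using e edges by (metis imageI)
  qed
  have M: "f v \<in> {1..K}" if "v \<in> M" for v
    using that inner by (auto simp: M_def f_def)
  have "inj_on f N"
  proof (rule inj_onI)
    fix v w assume "v \<in> N" "w \<in> N" "f v = f w"
    then have "g {None, v} = g {None, w}"
      using N(4) by simp
    then have "{None, v} = {None, w}"
      using bij N(3) \<open>v \<in> N\<close> \<open>w \<in> N\<close> by (meson bij_betw_imp_inj_on inj_onD)
    then show "v = w"
      by (auto simp: doubleton_eq_iff)
  qed
  moreover have "inj_on f M"
    using inj by (auto simp: inj_on_def M_def f_def dest: sym)
  moreover have "f v \<noteq> f w" if "v \<in> N" "w \<in> M" for v w
    using N(1)[OF that(1)] M[OF that(2)] by auto
  moreover have "f v \<noteq> 0" if "v \<in> N \<union> M" for v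
    using that N(1) M \<open>K \<ge> 0\<close> by fastforce
  ultimately have "inj_on f (insert None (N \<union> M))"
    using \<open>f None = 0\<close> by (auto simp: inj_on_def) metis+
  then have "inj_on f (verts G)"
    using verts inj_on_subset by blast
  moreover have "f ` verts G \<subseteq> {0..K} \<union> X"
    using verts N(2) M \<open>f None = 0\<close> \<open>K \<ge> 0\<close> by fastforce
  ultimately show ?thesis
    using card_edges induced bij by blast
qed

text \<open>The edge labels form four blocks: \<open>1..p\<close> are the gaps of \<open>V\<close>,
  \<open>p + 1..p + t\<close> the gaps of \<open>L\<close>, \<open>p + t + 1..s\<close> the shifted
  ends of \<open>L\<close>, and \<open>s + W\<close> the shifted ends of \<open>P\<close>. Leaving
  \<open>W\<close> open serves both the graceful and the near graceful case.\<close>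

lemma langford_pentagons_labelling:
  fixes t p :: nat
  defines "G \<equiv> join_centres (cycles_at_point 3 t) (cycles_at_point 5 p)"
    and "s \<equiv> int p + 3 * int t"
  assumes t: "2 * p + 1 \<le> t" and L: "langford (int p + 1) (int t) L"
    and PV: "pentagons (int p) W P V" and W: "W \<subseteq> {1..}"
  shows "\<exists>f g. card (edges G) = 3 * t + 5 * p \<and> inj_on f (verts G) \<and>
    f ` verts G \<subseteq> {0..s} \<union> (+) s ` W \<and> induced_edge_labelling G f g \<and>
    bij_betw g (edges G) ({1..s} \<union> (+) s ` W)"
proof -
  let ?K = "int p + int t"
  let ?X = "{1..s} \<union> (+) s ` W"
  have L: "length L = t" "set (ends L) = {1..2 * int t}" "set (gaps L) = {int p + 1..<int p + 1 + int t}"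
    using L by (simp_all add: langford_def)
  \<comment> \<open>The bound \<open>3 * p + 1\<close> is at most \<open>?K\<close> because
    \<open>2 * p + 1 \<le> t\<close>.\<close>
  have PV: "length V = p" "card W = 4 * p" "set (ends P) = W" "distinct (gaps P)"
      "set (gaps P) = set (ends V)" "distinct (ends V)" "set (ends V) \<subseteq> {1..?K}" "set (gaps V) = {1..int p}"
    using PV t by (auto simp: pentagons_def)
  have "\<exists>x. (x, x + e) \<in> set P" if "e \<in> set (ends V)" for e
    using that unfolding PV(5)[symmetric] in_gaps_iff .
  \<comment> \<open>\<open>h e\<close> is the lower end of the pair of \<open>P\<close> with gap
    \<open>e\<close>; distinctness of the gaps makes this pair unique
    (\<open>h_unique\<close>).\<close>
  then obtain h where h: "\<And>e. e \<in> set (ends V) \<Longrightarrow> (h e, h e + e) \<in> set P"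
    by metis
  have h_in_W: "h e \<in> W" "h e + e \<in> W" if "e \<in> set (ends V)" for e
    using h[OF that] PV(3) by (force simp: ends_def)+
  have h_unique: "h (y - x) = x" "y - x \<in> set (ends V)" if "(x, y) \<in> set P" for x y
  proof -
    show *: "y - x \<in> set (ends V)"
      using that unfolding PV(5)[symmetric] in_gaps_iff by (intro exI[of _ x]) simp
    have "inj_on (\<lambda>(x, y). y - x) (set P)"
      using PV(4) by (simp add: gaps_def distinct_map)
    from inj_onD[OF this _ h[OF *] that] show "h (y - x) = x"
      by simp
  qed
  define y where "y i = ?K + fst (L ! i)" for i
  define z where "z i = ?K + snd (L ! i)" for i
  define b where "b i = fst (V ! i)" for i
  define c where "c i = snd (V ! i)" for i
  \<comment> \<open>The shifted upper end of the pair with gap \<open>b i\<close>, so that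
    \<open>a i - b i\<close> is its shifted lower end.\<close>
  define a where "a i = s + h (b i) + b i" for i
  define d where "d i = s + h (c i) + c i" for i
  have bc: "b i \<in> set (ends V)" "c i \<in> set (ends V)" if "i < p" for i
    using that PV(1) by (auto simp: ends_def b_def c_def)
  have bc_cases: "\<exists>i<p. e = b i \<or> e = c i" if "e \<in> set (ends V)" for e
    using that PV(1) by (fastforce simp: ends_def b_def c_def in_set_conv_nth)
  have yz: "y i \<in> {?K + 1..s}" "z i \<in> {?K + 1..s}" if "i < t" for i
  proof -
    have "fst (L ! i) \<in> set (ends L)" "snd (L ! i) \<in> set (ends L)"
      using that L(1) by (auto simp: ends_def)
    then show "y i \<in> {?K + 1..s}" "z i \<in> {?K + 1..s}"
      unfolding L(2) by (auto simp: y_def z_def s_def)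
  qed
  let ?C = "(\<Union>i<t. {y i, z i, \<bar>y i - z i\<bar>}) \<union>
    (\<Union>i<p. {a i, \<bar>a i - b i\<bar>, \<bar>b i - c i\<bar>, \<bar>c i - d i\<bar>, d i})"
  have cover: "x \<in> ?C" if "x \<in> ?X" for x
  proof -
    consider "x \<in> {1..int p}" | "x \<in> {int p + 1..<int p + 1 + int t}"
      | "x - ?K \<in> {1..2 * int t}" | "x - s \<in> W"
      using \<open>x \<in> ?X\<close> by (fastforce simp: s_def)
    then show ?thesis
    proof cases
      case 1
      then obtain i where "i < p" "x = c i - b i"
        unfolding PV(8)[symmetric] using PV(1)
        by (auto simp: gaps_def in_set_conv_nth b_def c_def case_prod_beta)
      then show ?thesis
        using 1 by (intro UnI2 UN_I[of i]) auto
    next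
      case 2
      then obtain i where "i < t" "x = z i - y i"
        unfolding L(3)[symmetric] using L(1)
        by (auto simp: gaps_def in_set_conv_nth y_def z_def case_prod_beta)
      then show ?thesis
        using 2 by (intro UnI1 UN_I[of i]) auto
    next
      case 3
      then obtain i where "i < t" "x - ?K = fst (L ! i) \<or> x - ?K = snd (L ! i)"
        unfolding L(2)[symmetric] using L(1) by (auto simp: ends_def in_set_conv_nth)
      then show ?thesis
        by (intro UnI1 UN_I[of i]) (auto simp: y_def z_def)
    next
      case 4
      then obtain u v where uv: "(u, v) \<in> set P" "x - s = u \<or> x - s = v"
        unfolding PV(3)[symmetric] by (auto simp: ends_def)
      then obtain i where i: "i < p" "v - u = b i \<or> v - u = c i"
        using bc_cases h_unique(2) by metis
      \<comment> \<open>Whichever of \<open>b i\<close>, \<open>c i\<close> is the gap, the matching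
        difference is \<open>s + u\<close>; positivity removes the absolute value.\<close>
      have "u > 0" "s \<ge> 0"
        using uv(1) PV(3) W by (force simp: ends_def s_def)+
      with uv i h_unique(1)[OF uv(1)] have "x \<in> {a i, \<bar>a i - b i\<bar>, \<bar>c i - d i\<bar>, d i}"
        by (auto simp: a_def d_def)
      then show ?thesis
        using i(1) by blast
    qed
  qed
  have "finite W"
    using PV(3) by auto
  moreover have "{1..s} \<inter> (+) s ` W = {}"
    using W by auto
  ultimately have cardX: "card ?X = 3 * t + 5 * p"
    by (simp add: card_Un_disjoint card_image PV(2) s_def)
  have ad: "?K < a i \<and> ?K < d i" if "i < p" for i
    using h_in_W(2) bc[OF that] W by (force simp: a_def d_def s_def)
  have bc_K: "b i \<in> {1..?K} \<and> c i \<in> {1..?K}" if "i < p" for i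
    using bc[OF that] PV(7) by blast
  have "distinct (map fst V)" "distinct (map snd V)"
    using PV(6) by (simp_all add: ends_def)
  then have inj: "inj_on b {..<p}" "inj_on c {..<p}"
    using PV(1) by (auto simp: inj_on_def b_def c_def distinct_conv_nth)
  have neq: "b i \<noteq> c j" if "i < p" "j < p" for i j
  proof -
    have "b i \<in> fst ` set V" "c j \<in> snd ` set V"
      using that PV(1) by (simp_all add: b_def c_def)
    then show ?thesis
      using PV(6) unfolding ends_def distinct_append set_map by (metis disjoint_iff)
  qed
  have "?K \<ge> 0"
    by simp
  have "?X \<subseteq> ?C"
    using cover by (rule subsetI)
  have yz_K: "?K < y i \<and> ?K < z i" if "i < t" for i
    using yz[OF that] by simp
  from windmill_labelling[OF \<open>?K \<ge> 0\<close> cardX \<open>?X \<subseteq> ?C\<close> yz_K ad bc_K inj neq, folded G_def]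
  obtain f g where "card (edges G) = 3 * t + 5 * p" "inj_on f (verts G)"
      "f ` verts G \<subseteq> {0..?K} \<union> ?X" "induced_edge_labelling G f g" "bij_betw g (edges G) ?X"
    by blast
  moreover have "{0..?K} \<union> ?X \<subseteq> {0..s} \<union> (+) s ` W"
    by (auto simp: s_def)
  ultimately show ?thesis
    by blast
qed

section \<open>Graceful and near graceful labellings from tables\<close>

lemma graceful_if_pentagons:
  fixes t p :: nat
  assumes "2 * p + 1 \<le> t" and "langford (int p + 1) (int t) L" and "pentagons (int p) {1..4 * int p} P V"
  shows "graceful (join_centres (cycles_at_point 3 t) (cycles_at_point 5 p))"
proof -
  have "(+) (int p + 3 * int t) ` {1..4 * int p} = {int p + 3 * int t + 1..3 * int t + 5 * int p}"
    by (simp add: image_add_atLeastAtMost algebra_simps)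
  \<comment> \<open>The case \<open>l = 0\<close> serves the vertex labels, \<open>l = 1\<close> the
    edge labels.\<close>
  then have "{l..int p + 3 * int t} \<union> (+) (int p + 3 * int t) ` {1..4 * int p} = {l..3 * int t + 5 * int p}"
    if "l \<le> 1" for l
    using that by auto
  then show ?thesis
    using langford_pentagons_labelling[OF assms]
    by (auto simp: graceful_def graceful_labelling_def Let_def)
qed

text \<open>This is the second form of near gracefulness: label \<open>m\<close> is skipped and
  \<open>m + 1\<close> used. By \<open>p \<ge> 1\<close>, the blocks below the gap join to one
  interval ending at \<open>m - 1\<close>.\<close>

lemma near_graceful_if_pentagons:
  fixes t p :: nat
  assumes "2 * p + 1 \<le> t" and "langford (int p + 1) (int t) L" and "p \<ge> 1"
    and "pentagons (int p) (insert (4 * int p + 1) {1..4 * int p - 1}) P V"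
  shows "near_graceful (join_centres (cycles_at_point 3 t) (cycles_at_point 5 p))"
proof -
  let ?G = "join_centres (cycles_at_point 3 t) (cycles_at_point 5 p)"
  let ?s = "int p + 3 * int t" and ?m = "3 * int t + 5 * int p"
  have W: "(+) ?s ` insert (4 * int p + 1) {1..4 * int p - 1} = insert (?m + 1) {?s + 1..?m - 1}"
    by (simp add: image_add_atLeastAtMost algebra_simps)
  have X: "{l..?s} \<union> (+) ?s ` insert (4 * int p + 1) {1..4 * int p - 1} = {l..?m - 1} \<union> {?m + 1}"
    if "l \<le> 1" for l
    unfolding W using that \<open>p \<ge> 1\<close> by auto
  have "insert (4 * int p + 1) {1..4 * int p - 1} \<subseteq> {1..}"
    by auto
  from langford_pentagons_labelling[OF assms(1,2,4) this, unfolded X[of 0, OF zero_le_one] X[of 1, OF order_refl]]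
  obtain f g where fg: "card (edges ?G) = 3 * t + 5 * p" "inj_on f (verts ?G)"
    "f ` verts ?G \<subseteq> {0..?m - 1} \<union> {?m + 1}"
    "induced_edge_labelling ?G f g" "bij_betw g (edges ?G) ({1..?m - 1} \<union> {?m + 1})"
    by blast
  have m: "int (card (edges ?G)) = ?m"
    using fg(1) by simp
  have "{0..?m - 1} \<union> {?m + 1} \<subseteq> {0..?m + 1}"
    by auto
  with fg(3) have range: "f ` verts ?G \<subseteq> {0..?m + 1}"
    by (rule order_trans)
  have "near_graceful_labelling ?G f"
    unfolding near_graceful_labelling_def Let_def m
    by (intro conjI exI[of _ g] disjI2; fact fg range)
  then show ?thesis
    by (auto simp: near_graceful_def)
qed

section \<open>Covering criteria and Langford tables\<close>

lemma langfordI: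
  assumes "int (length L) = l"
    and "\<And>z. 1 \<le> z \<Longrightarrow> z \<le> 2 * l \<Longrightarrow> z \<in> set (ends L)"
    and "\<And>z. d \<le> z \<Longrightarrow> z < d + l \<Longrightarrow> z \<in> set (gaps L)"
  shows "langford d l L"
proof -
  have "set (ends L) = {1..2 * l}" "set (gaps L) = {d..<d + l}"
    using assms by (auto intro!: covering_list(1))
  then show ?thesis
    using assms(1) by (simp add: langford_def)
qed

text \<open>\<open>B\<close> is the common set of gaps of \<open>P\<close> and ends of
  \<open>V\<close>. Naming it reduces their equality and distinctness to two coverings of a set of
  size \<open>2 * p\<close>.\<close>

lemma pentagonsI:
  assumes len: "int (length P) = 2 * p" "int (length V) = p"
    and card: "int (card W) = 4 * p" "int (card B) = 2 * p"
    and B: "B \<subseteq> {1..3 * p + 1}"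
    and cover: "\<And>z. z \<in> W \<Longrightarrow> z \<in> set (ends P)" "\<And>z. z \<in> B \<Longrightarrow> z \<in> set (ends V)"
      "\<And>z. z \<in> B \<Longrightarrow> z \<in> set (gaps P)" "\<And>z. 1 \<le> z \<Longrightarrow> z \<le> p \<Longrightarrow> z \<in> set (gaps V)"
  shows "pentagons p W P V"
proof -
  have "set (ends P) = W"
    using len card cover(1) by (intro covering_list) auto
  moreover have "set (ends V) = B" "distinct (ends V)"
    using covering_list[of B "ends V"] len card cover(2) by auto
  moreover have "set (gaps P) = B" "distinct (gaps P)"
    using covering_list[of B "gaps P"] len card cover(3) by auto
  moreover have "set (gaps V) = {1..p}"
    using len cover(4) by (intro covering_list) auto
  ultimately show ?thesis
    using len card B by (simp add: pentagons_def)
qed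

text \<open>The tables below were found by a computer search for solutions that consist of few nests. The
  Langford sequences split into four cases according to the parity of the defect and the order modulo 4.\<close>

schematic_goal langford_even_3:
  fixes i j :: int
  assumes "i \<ge> 0" "j \<ge> 0"
  shows "langford (2 + 2 * j) (3 + 4 * i + 4 * j) ?table"
proof (rule langfordI)
  let ?L = "nest 1 (2 + 4 * i + 2 * j) i
      @ nest (1 + i) (1 + 3 * i + 2 * j) i
      @ nest (1 + 2 * i) (5 + 6 * i + 6 * j) j
      @ nest (1 + 2 * i + j) (4 + 6 * i + 5 * j) (1 + j)
      @ nest (2 + 3 * i + 2 * j) (6 + 7 * i + 6 * j) 1
      @ nest (3 + 4 * i + 2 * j) (6 + 8 * i + 8 * j) j
      @ nest (3 + 4 * i + 3 * j) (5 + 6 * i + 5 * j) 1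
      @ nest (4 + 4 * i + 3 * j) (6 + 8 * i + 7 * j) (i + j)
      @ nest (4 + 5 * i + 4 * j) (5 + 7 * i + 6 * j) i"
  \<comment> \<open>This first \<open>show\<close> instantiates the schematic \<open>?table\<close>
    with \<open>?L\<close>.\<close>
  show "int (length ?L) = 3 + 4 * i + 4 * j"
    using assms by simp
  show "z \<in> set (ends ?L)" if "1 \<le> z" "z \<le> 2 * (3 + 4 * i + 4 * j)" for z
    using that assms unfolding in_ends_iffs
    \<comment> \<open>The pattern confines \<open>ccontr\<close> to the disjunction; otherwise
      \<open>intro\<close> would apply it again to \<open>False\<close>.\<close>
    by (intro ccontr[of "_ \<or> _"])
      (simp only: de_Morgan_conj de_Morgan_disj not_less not_le, elim conjE, simp)
  show "z \<in> set (gaps ?L)" if "2 + 2 * j \<le> z" "z < 2 + 2 * j + (3 + 4 * i + 4 * j)" for z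
    using that assms unfolding in_gaps_iffs
    \<comment> \<open>All gaps of one nest have the same parity, so fixing that of \<open>z\<close>
      leaves interval conditions.\<close>
    by (cases "even z"; intro ccontr[of "_ \<or> _"];
        simp only: de_Morgan_conj de_Morgan_disj not_less not_le; elim conjE; simp; presburger)
qed

\<comment> \<open>With \<open>d = 3 + 2 * j\<close>, the order at \<open>i = 0\<close> is the least
  possible one, \<open>2 * d - 1\<close>; each unit of \<open>i\<close> adds 4. Within each parity
  the gaps of the nests continue one another, and the two single pairs fill the values
  \<open>3 + 2 * i + 2 * j\<close> and \<open>6 + 4 * i + 4 * j\<close>.\<close>
schematic_goal langford_odd_1:
  fixes i j :: int
  assumes "i \<ge> 0" "j \<ge> 0"
  shows "langford (3 + 2 * j) (5 + 4 * i + 4 * j) ?table"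
proof (rule langfordI)
  let ?L = "nest 1 (3 + 4 * i + 2 * j) i
      @ nest (1 + i) (2 + 3 * i + 2 * j) i
      @ nest (1 + 2 * i) (8 + 6 * i + 6 * j) (1 + j)
      @ nest (2 + 2 * i + j) (6 + 6 * i + 5 * j) (1 + j)
      @ nest (3 + 3 * i + 2 * j) (9 + 7 * i + 6 * j) 1
      @ nest (4 + 4 * i + 2 * j) (10 + 8 * i + 8 * j) j
      @ nest (4 + 4 * i + 3 * j) (7 + 6 * i + 5 * j) 1
      @ nest (5 + 4 * i + 3 * j) (10 + 8 * i + 7 * j) (1 + i + j)
      @ nest (6 + 5 * i + 4 * j) (8 + 7 * i + 6 * j) i"
  show "int (length ?L) = 5 + 4 * i + 4 * j"
    using assms by simp
  show "z \<in> set (ends ?L)" if "1 \<le> z" "z \<le> 2 * (5 + 4 * i + 4 * j)" for z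
    using that assms unfolding in_ends_iffs
    by (intro ccontr[of "_ \<or> _"])
      (simp only: de_Morgan_conj de_Morgan_disj not_less not_le, elim conjE, simp)
  show "z \<in> set (gaps ?L)" if "3 + 2 * j \<le> z" "z < 3 + 2 * j + (5 + 4 * i + 4 * j)" for z
    using that assms unfolding in_gaps_iffs
    by (cases "even z"; intro ccontr[of "_ \<or> _"];
        simp only: de_Morgan_conj de_Morgan_disj not_less not_le; elim conjE; simp; presburger)
qed

schematic_goal langford_even_0:
  fixes i j :: int
  assumes "i \<ge> 0" "j \<ge> 0"
  shows "langford (2 + 2 * j) (4 + 4 * i + 4 * j) ?table"
proof (rule langfordI)
  let ?L = "nest 1 (3 + 4 * i + 2 * j) i
      @ nest (1 + i) (2 + 3 * i + 2 * j) i
      @ nest (1 + 2 * i) (6 + 6 * i + 6 * j) (1 + j)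
      @ nest (2 + 2 * i + j) (4 + 4 * i + 3 * j) 1
      @ nest (3 + 2 * i + j) (5 + 6 * i + 5 * j) j
      @ nest (3 + 3 * i + 2 * j) (7 + 7 * i + 6 * j) 1
      @ nest (4 + 4 * i + 2 * j) (8 + 8 * i + 8 * j) j
      @ nest (5 + 4 * i + 3 * j) (8 + 8 * i + 7 * j) (1 + i + j)
      @ nest (6 + 5 * i + 4 * j) (6 + 7 * i + 6 * j) i"
  show "int (length ?L) = 4 + 4 * i + 4 * j"
    using assms by simp
  show "z \<in> set (ends ?L)" if "1 \<le> z" "z \<le> 2 * (4 + 4 * i + 4 * j)" for z
    using that assms unfolding in_ends_iffs
    by (intro ccontr[of "_ \<or> _"])
      (simp only: de_Morgan_conj de_Morgan_disj not_less not_le, elim conjE, simp)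
  show "z \<in> set (gaps ?L)" if "2 + 2 * j \<le> z" "z < 2 + 2 * j + (4 + 4 * i + 4 * j)" for z
    using that assms unfolding in_gaps_iffs
    by (cases "even z"; intro ccontr[of "_ \<or> _"];
        simp only: de_Morgan_conj de_Morgan_disj not_less not_le; elim conjE; simp; presburger)
qed

\<comment> \<open>The constant 8 arises because \<open>8 + 4 * j\<close> is the least multiple of 4
  that is at least \<open>2 * d - 1 = 5 + 4 * j\<close>.\<close>
schematic_goal langford_odd_0:
  fixes i j :: int
  assumes "i \<ge> 0" "j \<ge> 0"
  shows "langford (3 + 2 * j) (8 + 4 * i + 4 * j) ?table"
proof (rule langfordI)
  let ?L = "nest 1 (6 + 4 * i + 2 * j) (1 + i)
      @ nest (2 + i) (4 + 3 * i + 2 * j) i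
      @ nest (2 + 2 * i) (12 + 6 * i + 6 * j) (1 + j)
      @ nest (3 + 2 * i + j) (7 + 4 * i + 3 * j) 1
      @ nest (4 + 2 * i + j) (11 + 6 * i + 5 * j) (1 + j)
      @ nest (5 + 3 * i + 2 * j) (14 + 7 * i + 6 * j) 1
      @ nest (7 + 4 * i + 2 * j) (16 + 8 * i + 8 * j) j
      @ nest (8 + 4 * i + 3 * j) (16 + 8 * i + 7 * j) (2 + i + j)
      @ nest (10 + 5 * i + 4 * j) (13 + 7 * i + 6 * j) (1 + i)"
  show "int (length ?L) = 8 + 4 * i + 4 * j"
    using assms by simp
  show "z \<in> set (ends ?L)" if "1 \<le> z" "z \<le> 2 * (8 + 4 * i + 4 * j)" for z
    using that assms unfolding in_ends_iffs
    by (intro ccontr[of "_ \<or> _"])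
      (simp only: de_Morgan_conj de_Morgan_disj not_less not_le, elim conjE, simp)
  show "z \<in> set (gaps ?L)" if "3 + 2 * j \<le> z" "z < 3 + 2 * j + (8 + 4 * i + 4 * j)" for z
    using that assms unfolding in_gaps_iffs
    by (cases "even z"; intro ccontr[of "_ \<or> _"];
        simp only: de_Morgan_conj de_Morgan_disj not_less not_le; elim conjE; simp; presburger)
qed

\<comment> \<open>Pentagon tables, by the residue of the number of pentagons modulo 4\<close>
schematic_goal pentagons_0:
  fixes u :: int
  assumes "u \<ge> 0"
  shows "pentagons (4 + 4 * u) {1..16 + 16 * u} ?pairs ?differences"
proof (rule pentagonsI)
  \<comment> \<open>The first nest yields the gaps of parity opposite to \<open>u\<close>, the
    second and fourth those of the parity of \<open>u\<close>. The single pair holds the largest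
    label and has the outlying gap \<open>11 + 11 * u\<close>.\<close>
  let ?P = "nest 1 (8 + 9 * u) (3 + 4 * u)
      @ nest (4 + 4 * u) (12 + 13 * u) (1 + u)
      @ nest (5 + 5 * u) (16 + 16 * u) 1
      @ nest (9 + 9 * u) (15 + 16 * u) (3 + 3 * u)"
  \<comment> \<open>The first nest gives the odd and the second the even differences below
    \<open>4 + 4 * u\<close>. The second leaves out its midpoint \<open>7 + 7 * u\<close>, which is
    paired with the outlier to give \<open>4 + 4 * u\<close> itself. \<open>pentagons_1\<close> and
    \<open>pentagons_2\<close> follow the same pattern.\<close>
  let ?V = "nest (2 + u) (5 + 5 * u) (2 + 2 * u)
      @ nest (6 + 5 * u) (8 + 9 * u) (1 + 2 * u)
      @ nest (7 + 7 * u) (11 + 11 * u) 1"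
  show "int (length ?P) = 2 * (4 + 4 * u)" "int (length ?V) = 4 + 4 * u"
    using assms by simp_all
  show "int (card {1..16 + 16 * u}) = 4 * (4 + 4 * u)"
    "int (card (insert (11 + 11 * u) {2 + u..8 + 9 * u})) = 2 * (4 + 4 * u)"
    using assms by simp_all
  show "insert (11 + 11 * u) {2 + u..8 + 9 * u} \<subseteq> {1..3 * (4 + 4 * u) + 1}"
    using assms by auto
  show "z \<in> set (ends ?P)" if "z \<in> {1..16 + 16 * u}" for z
    using that assms unfolding in_ends_iffs
    by (intro ccontr[of "_ \<or> _"])
      (simp only: de_Morgan_conj de_Morgan_disj not_less not_le, elim conjE, simp)
  show "z \<in> set (ends ?V)" if "z \<in> insert (11 + 11 * u) {2 + u..8 + 9 * u}" for z
  proof (cases "z = 11 + 11 * u")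
    case False
    with that have "2 + u \<le> z" "z \<le> 8 + 9 * u"
      by auto
    with assms show ?thesis unfolding in_ends_iffs
      by (intro ccontr[of "_ \<or> _"])
        (simp only: de_Morgan_conj de_Morgan_disj not_less not_le, elim conjE, simp)
  qed (use assms in simp)
  show "z \<in> set (gaps ?P)" if "z \<in> insert (11 + 11 * u) {2 + u..8 + 9 * u}" for z
  proof (cases "z = 11 + 11 * u")
    case False
    with that have "2 + u \<le> z" "z \<le> 8 + 9 * u"
      by auto
    with assms show ?thesis unfolding in_gaps_iffs
      by (cases "even u"; cases "even z"; intro ccontr[of "_ \<or> _"];
        simp only: de_Morgan_conj de_Morgan_disj not_less not_le; elim conjE; simp; presburger)
  qed (use assms in simp)
  show "z \<in> set (gaps ?V)" if "1 \<le> z" "z \<le> 4 + 4 * u" for z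
    using that assms unfolding in_gaps_iffs
    by (cases "even u"; cases "even z"; intro ccontr[of "_ \<or> _"];
        simp only: de_Morgan_conj de_Morgan_disj not_less not_le; elim conjE; simp; presburger)
qed

schematic_goal pentagons_1:
  fixes u :: int
  assumes "u \<ge> 0"
  shows "pentagons (1 + 4 * u) (insert (5 + 16 * u) {1..3 + 16 * u}) ?pairs ?differences"
proof (rule pentagonsI)
  let ?P = "nest 1 (2 + 9 * u) (4 * u)
      @ nest (1 + 4 * u) (3 + 13 * u) (1 + u)
      @ nest (2 + 5 * u) (5 + 16 * u) 1
      @ nest (3 + 9 * u) (3 + 16 * u) (3 * u)"
  let ?V = "nest (2 + u) (1 + 5 * u) (2 * u)
      @ nest (2 + 5 * u) (2 + 9 * u) (2 * u)
      @ nest (2 + 7 * u) (3 + 11 * u) 1"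
  show "int (length ?P) = 2 * (1 + 4 * u)" "int (length ?V) = 1 + 4 * u"
    using assms by simp_all
  show "int (card (insert (5 + 16 * u) {1..3 + 16 * u})) = 4 * (1 + 4 * u)"
    "int (card (insert (3 + 11 * u) {2 + u..2 + 9 * u})) = 2 * (1 + 4 * u)"
    using assms by simp_all
  show "insert (3 + 11 * u) {2 + u..2 + 9 * u} \<subseteq> {1..3 * (1 + 4 * u) + 1}"
    using assms by auto
  show "z \<in> set (ends ?P)" if "z \<in> insert (5 + 16 * u) {1..3 + 16 * u}" for z
  proof (cases "z = 5 + 16 * u")
    case False
    with that have "1 \<le> z" "z \<le> 3 + 16 * u"
      by auto
    with assms show ?thesis unfolding in_ends_iffs
      by (intro ccontr[of "_ \<or> _"])
        (simp only: de_Morgan_conj de_Morgan_disj not_less not_le, elim conjE, simp)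
  qed (use assms in simp)
  show "z \<in> set (ends ?V)" if "z \<in> insert (3 + 11 * u) {2 + u..2 + 9 * u}" for z
  proof (cases "z = 3 + 11 * u")
    case False
    with that have "2 + u \<le> z" "z \<le> 2 + 9 * u"
      by auto
    with assms show ?thesis unfolding in_ends_iffs
      by (intro ccontr[of "_ \<or> _"])
        (simp only: de_Morgan_conj de_Morgan_disj not_less not_le, elim conjE, simp)
  qed (use assms in simp)
  show "z \<in> set (gaps ?P)" if "z \<in> insert (3 + 11 * u) {2 + u..2 + 9 * u}" for z
  proof (cases "z = 3 + 11 * u")
    case False
    with that have "2 + u \<le> z" "z \<le> 2 + 9 * u"
      by auto
    \<comment> \<open>The first nest only reaches \<open>1 + 9 * u\<close>. For \<open>z\<close> of
      parity opposite to \<open>u\<close> the value \<open>2 + 9 * u\<close> must be excluded, which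
      linear arithmetic cannot infer from parity.\<close>
    moreover have "z = 2 + 9 * u \<Longrightarrow> even z \<longleftrightarrow> even u"
      by simp
    ultimately show ?thesis using assms unfolding in_gaps_iffs
      by (cases "even u"; cases "even z"; intro ccontr[of "_ \<or> _"];
        simp only: de_Morgan_conj de_Morgan_disj not_less not_le; elim conjE; simp; linarith)
  qed (use assms in simp)
  show "z \<in> set (gaps ?V)" if "1 \<le> z" "z \<le> 1 + 4 * u" for z
    using that assms unfolding in_gaps_iffs
    by (cases "even u"; cases "even z"; intro ccontr[of "_ \<or> _"];
        simp only: de_Morgan_conj de_Morgan_disj not_less not_le; elim conjE; simp; presburger)
qed

schematic_goal pentagons_2:
  fixes u :: int
  assumes "u \<ge> 0"
  shows "pentagons (2 + 4 * u) (insert (9 + 16 * u) {1..7 + 16 * u}) ?pairs ?differences"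
proof (rule pentagonsI)
  let ?P = "nest 1 (4 + 9 * u) (1 + 4 * u)
      @ nest (2 + 4 * u) (6 + 13 * u) (1 + u)
      @ nest (3 + 5 * u) (9 + 16 * u) 1
      @ nest (5 + 9 * u) (7 + 16 * u) (1 + 3 * u)"
  let ?V = "nest (2 + u) (3 + 5 * u) (1 + 2 * u)
      @ nest (4 + 5 * u) (4 + 9 * u) (2 * u)
      @ nest (4 + 7 * u) (6 + 11 * u) 1"
  show "int (length ?P) = 2 * (2 + 4 * u)" "int (length ?V) = 2 + 4 * u"
    using assms by simp_all
  show "int (card (insert (9 + 16 * u) {1..7 + 16 * u})) = 4 * (2 + 4 * u)"
    "int (card (insert (6 + 11 * u) {2 + u..4 + 9 * u})) = 2 * (2 + 4 * u)"
    using assms by simp_all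
  show "insert (6 + 11 * u) {2 + u..4 + 9 * u} \<subseteq> {1..3 * (2 + 4 * u) + 1}"
    using assms by auto
  show "z \<in> set (ends ?P)" if "z \<in> insert (9 + 16 * u) {1..7 + 16 * u}" for z
  proof (cases "z = 9 + 16 * u")
    case False
    with that have "1 \<le> z" "z \<le> 7 + 16 * u"
      by auto
    with assms show ?thesis unfolding in_ends_iffs
      by (intro ccontr[of "_ \<or> _"])
        (simp only: de_Morgan_conj de_Morgan_disj not_less not_le, elim conjE, simp)
  qed (use assms in simp)
  show "z \<in> set (ends ?V)" if "z \<in> insert (6 + 11 * u) {2 + u..4 + 9 * u}" for z
  proof (cases "z = 6 + 11 * u")
    case False
    with that have "2 + u \<le> z" "z \<le> 4 + 9 * u"
      by auto
    with assms show ?thesis unfolding in_ends_iffs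
      by (intro ccontr[of "_ \<or> _"])
        (simp only: de_Morgan_conj de_Morgan_disj not_less not_le, elim conjE, simp)
  qed (use assms in simp)
  show "z \<in> set (gaps ?P)" if "z \<in> insert (6 + 11 * u) {2 + u..4 + 9 * u}" for z
  proof (cases "z = 6 + 11 * u")
    case False
    with that have "2 + u \<le> z" "z \<le> 4 + 9 * u"
      by auto
    with assms show ?thesis unfolding in_gaps_iffs
      by (cases "even u"; cases "even z"; intro ccontr[of "_ \<or> _"];
        simp only: de_Morgan_conj de_Morgan_disj not_less not_le; elim conjE; simp; presburger)
  qed (use assms in simp)
  show "z \<in> set (gaps ?V)" if "1 \<le> z" "z \<le> 2 + 4 * u" for z
    using that assms unfolding in_gaps_iffs
    by (cases "even u"; cases "even z"; intro ccontr[of "_ \<or> _"];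
        simp only: de_Morgan_conj de_Morgan_disj not_less not_le; elim conjE; simp; presburger)
qed

\<comment> \<open>There is no outlier here: the nest of even differences leaves out its midpoint
  \<open>2 + 3 * u\<close>, so the gaps of \<open>?P\<close> must skip this value. The first two
  nests of \<open>?P\<close> give the gaps above it, the last two those below.\<close>
schematic_goal pentagons_3:
  fixes u :: int
  assumes "u \<ge> 0"
  shows "pentagons (3 + 4 * u) {1..12 + 16 * u} ?pairs ?differences"
proof (rule pentagonsI)
  let ?P = "nest 1 (8 + 9 * u) (3 + 3 * u)
      @ nest (4 + 3 * u) (10 + 12 * u) (2 + 3 * u)
      @ nest (11 + 12 * u) (12 + 15 * u) (1 + u)
      @ nest (12 + 13 * u) (12 + 16 * u) u"
  let ?V = "nest (1 + u) (3 + 5 * u) (1 + 2 * u)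
      @ nest (4 + 5 * u) (7 + 9 * u) (2 + 2 * u)"
  show "int (length ?P) = 2 * (3 + 4 * u)" "int (length ?V) = 3 + 4 * u"
    using assms by simp_all
  show "int (card {1..12 + 16 * u}) = 4 * (3 + 4 * u)"
    "int (card ({1 + u..7 + 9 * u} - {2 + 3 * u})) = 2 * (3 + 4 * u)"
    using assms by simp_all
  show "{1 + u..7 + 9 * u} - {2 + 3 * u} \<subseteq> {1..3 * (3 + 4 * u) + 1}"
    using assms by auto
  show "z \<in> set (ends ?P)" if "z \<in> {1..12 + 16 * u}" for z
    using that assms unfolding in_ends_iffs
    by (intro ccontr[of "_ \<or> _"])
      (simp only: de_Morgan_conj de_Morgan_disj not_less not_le, elim conjE, simp)
  show "z \<in> set (ends ?V)" if "z \<in> {1 + u..7 + 9 * u} - {2 + 3 * u}" for z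
  proof (cases "z < 2 + 3 * u")
    case True
    with that assms show ?thesis unfolding in_ends_iffs
      by (intro ccontr[of "_ \<or> _"])
        (simp only: de_Morgan_conj de_Morgan_disj not_less not_le, elim conjE, simp)
  next
    case False
    with that have "2 + 3 * u < z" "z \<le> 7 + 9 * u"
      by auto
    with assms show ?thesis unfolding in_ends_iffs
      by (intro ccontr[of "_ \<or> _"])
        (simp only: de_Morgan_conj de_Morgan_disj not_less not_le, elim conjE, simp)
  qed
  show "z \<in> set (gaps ?P)" if "z \<in> {1 + u..7 + 9 * u} - {2 + 3 * u}" for z
  proof (cases "z < 2 + 3 * u")
    case True
    \<comment> \<open>For \<open>z\<close> of the parity of \<open>u\<close> the last nest only
      reaches \<open>3 * u\<close>, so \<open>1 + 3 * u\<close> must be excluded.\<close>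
    moreover have "z = 1 + 3 * u \<Longrightarrow> even z \<longleftrightarrow> odd u"
      by simp
    ultimately show ?thesis using that assms unfolding in_gaps_iffs
      by (cases "even u"; cases "even z"; intro ccontr[of "_ \<or> _"];
        simp only: de_Morgan_conj de_Morgan_disj not_less not_le; elim conjE; simp; linarith)
  next
    case False
    with that have "2 + 3 * u < z" "z \<le> 7 + 9 * u"
      by auto
    with assms show ?thesis unfolding in_gaps_iffs
      by (cases "even u"; cases "even z"; intro ccontr[of "_ \<or> _"];
        simp only: de_Morgan_conj de_Morgan_disj not_less not_le; elim conjE; simp; presburger)
  qed
  show "z \<in> set (gaps ?V)" if "1 \<le> z" "z \<le> 3 + 4 * u" for z
    using that assms unfolding in_gaps_iffs
    by (cases "even u"; cases "even z"; intro ccontr[of "_ \<or> _"];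
        simp only: de_Morgan_conj de_Morgan_disj not_less not_le; elim conjE; simp; presburger)
qed

section \<open>Choice of the table parameters and conclusion\<close>

lemma langford_exists:
  fixes p t :: nat
  assumes t: "2 * p + 1 \<le> t" and p: "p \<ge> 1"
    and mods: "even p \<and> t mod 4 \<in> {0, 1} \<or> odd p \<and> t mod 4 \<in> {0, 3}"
  shows "\<exists>L. langford (int p + 1) (int t) L"
proof -
  \<comment> \<open>An even \<open>p\<close> gives an odd defect, and \<open>p \<ge> 1\<close> then
    ensures \<open>j \<ge> 0\<close>. Within the residue class of \<open>t\<close> modulo 4, the
    condition \<open>2 * p + 1 \<le> t\<close> amounts to \<open>i \<ge> 0\<close>.\<close>
  consider j i where "int p + 1 = 3 + 2 * j" "int t = 8 + 4 * i + 4 * j" "i \<ge> 0" "j \<ge> 0"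
    | j i where "int p + 1 = 3 + 2 * j" "int t = 5 + 4 * i + 4 * j" "i \<ge> 0" "j \<ge> 0"
    | j i where "int p + 1 = 2 + 2 * j" "int t = 4 + 4 * i + 4 * j" "i \<ge> 0" "j \<ge> 0"
    | j i where "int p + 1 = 2 + 2 * j" "int t = 3 + 4 * i + 4 * j" "i \<ge> 0" "j \<ge> 0"
  proof -
    consider k r where "p = 2 * k" "t = 4 * r" | k r where "p = 2 * k" "t = 4 * r + 1"
      | k r where "p = 2 * k + 1" "t = 4 * r" | k r where "p = 2 * k + 1" "t = 4 * r + 3"
    proof -
      have "t = 4 * (t div 4) + t mod 4" "even p \<Longrightarrow> p = 2 * (p div 2)" "odd p \<Longrightarrow> p = 2 * (p div 2) + 1"
        by simp_all
      then show ?thesis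
        using that mods by (elim disjE conjE insertE emptyE) (metis add.right_neutral)+
    qed
    then show ?thesis
    proof cases
      case 1
      then show ?thesis
        using that(1)[of "int k - 1" "int r - int k - 1"] t p by simp
    next
      case 2
      then show ?thesis
        using that(2)[of "int k - 1" "int r - int k"] t p by simp
    next
      case 3
      then show ?thesis
        using that(3)[of "int k" "int r - int k - 1"] t by simp
    next
      case 4
      then show ?thesis
        using that(4)[of "int k" "int r - int k"] t by simp
    qed
  qed
  then show ?thesis
    by cases (metis langford_odd_0, metis langford_odd_1, metis langford_even_0, metis langford_even_3)
qed

theorem theorem5p3:
  fixes p t :: nat
  assumes "p \<ge> 1" and "t \<ge> 2 * p + 1"
  defines "G \<equiv> join_centres (cycles_at_point 3 t) (cycles_at_point 5 p)"
  shows "(p mod 4 = 0 \<and> t mod 4 \<in> {0, 1} \<longrightarrow> graceful G) \<and>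
         (p mod 4 = 3 \<and> t mod 4 \<in> {0, 3} \<longrightarrow> graceful G) \<and>
         (p mod 4 = 1 \<and> t mod 4 \<in> {0, 3} \<longrightarrow> near_graceful G) \<and>
         (p mod 4 = 2 \<and> t mod 4 \<in> {0, 1} \<longrightarrow> near_graceful G)"
proof -
  define u where "u = int (p div 4)"
  have u: "u \<ge> 0"
    by (simp add: u_def)
  have p: "int p = 4 * u + int r" if "p mod 4 = r" for r
    using that mult_div_mod_eq[of 4 p] unfolding u_def by (metis of_nat_add of_nat_mult of_nat_numeral)
  have L_even: "\<exists>L. langford (int p + 1) (int t) L" if "p mod 4 = 0 \<or> p mod 4 = 2" "t mod 4 \<in> {0, 1}"
  proof -
    have "even p"
      using that(1) by presburger
    with that(2) show ?thesis
      using langford_exists[OF assms(2,1)] by simp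
  qed
  have L_odd: "\<exists>L. langford (int p + 1) (int t) L" if "p mod 4 = 1 \<or> p mod 4 = 3" "t mod 4 \<in> {0, 3}"
  proof -
    have "odd p"
      using that(1) by presburger
    with that(2) show ?thesis
      using langford_exists[OF assms(2,1)] by simp
  qed
  have "\<exists>P V. pentagons (int p) {1..4 * int p} P V" if "p mod 4 = 0"
  proof -
    \<comment> \<open>The table for residue 0 starts at \<open>p = 4\<close>, hence the shift to
      \<open>u - 1\<close>, which \<open>p \<ge> 1\<close> keeps nonnegative.\<close>
    have "4 + 4 * (u - 1) = int p" "16 + 16 * (u - 1) = 4 * int p" "0 \<le> u - 1"
      using p[OF that] assms(1) by simp_all
    then show ?thesis
      using pentagons_0[of "u - 1"] by metis
  qed
  moreover have "\<exists>P V. pentagons (int p) {1..4 * int p} P V" if "p mod 4 = 3"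
  proof -
    have "3 + 4 * u = int p" "12 + 16 * u = 4 * int p"
      using p[OF that] by simp_all
    then show ?thesis
      using pentagons_3[OF u] by metis
  qed
  moreover have "\<exists>P V. pentagons (int p) (insert (4 * int p + 1) {1..4 * int p - 1}) P V" if "p mod 4 = 1"
  proof -
    have "1 + 4 * u = int p" "5 + 16 * u = 4 * int p + 1" "3 + 16 * u = 4 * int p - 1"
      using p[OF that] by simp_all
    then show ?thesis
      using pentagons_1[OF u] by metis
  qed
  moreover have "\<exists>P V. pentagons (int p) (insert (4 * int p + 1) {1..4 * int p - 1}) P V" if "p mod 4 = 2"
  proof -
    have "2 + 4 * u = int p" "9 + 16 * u = 4 * int p + 1" "7 + 16 * u = 4 * int p - 1"
      using p[OF that] by simp_all
    then show ?thesis
      using pentagons_2[OF u] by metis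
  qed
  ultimately show ?thesis
    unfolding G_def
    by (intro conjI impI; elim conjE;
        metis L_even L_odd graceful_if_pentagons near_graceful_if_pentagons assms(1,2))
qed

end
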